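(* If $G$ is a graph with $n>3$ vertices and $G$ has acyclic dimension $3$, then the acyclic polynomial $A(G,x)$ has one real root and two nonreal roots.
   Context: Graphs are finite, undirected and simple. The acyclic polynomial of a graph $G$ is $A(G,x)=\sum_{i\ge 0} a_i x^i$, where $a_i=|\{S\subseteq V(G): |S|=i \text{ and } G[S] \text{ is acyclic}\}|$ and $G[S]$ is the subgraph of $G$ induced by $S$ (acyclic means containing no cycle; the empty set is acyclic). The acyclic dimension of $G$ is the maximum size of a vertex subset inducing an acyclic subgraph, equivalently the degree of $A(G,x)$. *)

theory Defs
  imports
    Complex_Main
    "HOL-Computational_Algebra.Polynomial"
    "Graph_Theory.Graph_Theory"
begin

text \<open>
  A finite simple undirected graph is a digraph satisfying the locale predicate
  \<^const>\<open>graph\<close>: finite, loop-free, without parallel arcs, and symmetric, so that every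
  undirected edge is represented by its two orientations.  In this encoding
  \<^const>\<open>pre_digraph.cycle\<close> also accepts the walk \<open>u, v, u\<close> along the two orientations of a
  single edge (hence \<^const>\<open>forest\<close> is not the intended notion); the cycles of the
  undirected graph are exactly those with at least three arcs.
\<close>

definition acyclic_graph :: "('a, 'b) pre_digraph \<Rightarrow> bool" where
  "acyclic_graph G \<longleftrightarrow> \<not> (\<exists>p. pre_digraph.cycle G p \<and> 3 \<le> length p)"

definition acyclic_sets :: "('a, 'b) pre_digraph \<Rightarrow> 'a set set" where
  "acyclic_sets G = {S. S \<subseteq> verts G \<and> acyclic_graph (G \<restriction> S)}"

definition acyclic_count :: "('a, 'b) pre_digraph \<Rightarrow> nat \<Rightarrow> nat" where
  "acyclic_count G i = card {S \<in> acyclic_sets G. card S = i}"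

text \<open>
  The sum over all \<open>i \<ge> 0\<close> is cut off at the number of vertices, beyond which every
  coefficient is zero (see \<open>coeff_acyclic_poly\<close> below).
\<close>

definition acyclic_poly :: "('a, 'b) pre_digraph \<Rightarrow> int poly" where
  "acyclic_poly G = (\<Sum>i\<le>card (verts G). monom (int (acyclic_count G i)) i)"

definition acyclic_dimension :: "('a, 'b) pre_digraph \<Rightarrow> nat" where
  "acyclic_dimension G = Max (card ` acyclic_sets G)"

lemma finite_acyclic_sets: "finite (verts G) \<Longrightarrow> finite (acyclic_sets G)"
  unfolding acyclic_sets_def by simp

lemma empty_in_acyclic_sets: "{} \<in> acyclic_sets G"
  by (auto simp: acyclic_sets_def acyclic_graph_def pre_digraph.cycle_def pre_digraph.awalk_def)

lemma coeff_acyclic_poly: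
  assumes "finite (verts G)"
  shows "coeff (acyclic_poly G) i = int (acyclic_count G i)"
proof (cases "i \<le> card (verts G)")
  case True
  then show ?thesis
    by (simp add: acyclic_poly_def coeff_sum if_distrib cong: if_cong)
next
  case False
  have "card S \<noteq> i" if "S \<in> acyclic_sets G" for S
    using that False card_mono[OF assms] by (fastforce simp: acyclic_sets_def)
  then have "acyclic_count G i = 0"
    unfolding acyclic_count_def by (metis (mono_tags, lifting) Collect_empty_eq card.empty)
  with False show ?thesis
    by (simp add: acyclic_poly_def coeff_sum if_distrib cong: if_cong)
qed

lemma degree_acyclic_poly:
  assumes "finite (verts G)"
  shows "degree (acyclic_poly G) = acyclic_dimension G"
proof (rule antisym)
  have fin: "finite (acyclic_sets G)"
    using assms by (rule finite_acyclic_sets)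
  show "degree (acyclic_poly G) \<le> acyclic_dimension G"
  proof (rule degree_le, intro allI impI)
    fix i assume i: "acyclic_dimension G < i"
    have "card S < i" if "S \<in> acyclic_sets G" for S
    proof -
      have "card S \<le> acyclic_dimension G"
        unfolding acyclic_dimension_def using fin that by (intro Max_ge) auto
      with i show ?thesis
        by simp
    qed
    then have "{S \<in> acyclic_sets G. card S = i} = {}"
      by auto
    then show "coeff (acyclic_poly G) i = 0"
      by (simp only: coeff_acyclic_poly[OF assms] acyclic_count_def card.empty of_nat_0)
  qed
  have "acyclic_dimension G \<in> card ` acyclic_sets G"
    unfolding acyclic_dimension_def using fin empty_in_acyclic_sets[of G] by (intro Max_in) auto
  then have "{S \<in> acyclic_sets G. card S = acyclic_dimension G} \<noteq> {}"
    by auto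
  then have "acyclic_count G (acyclic_dimension G) \<noteq> 0"
    using fin by (simp add: acyclic_count_def)
  then show "acyclic_dimension G \<le> degree (acyclic_poly G)"
    by (intro le_degree) (simp add: coeff_acyclic_poly[OF assms])
qed

end

theory Submission
  imports Defs
begin

text \<open>
  Every set of at most two vertices is acyclic, so a graph with \<open>n\<close> vertices and acyclic
  dimension \<open>3\<close> has \<open>A(G,x) = 1 + n x + C(n,2) x^2 + a x^3\<close> with \<open>a > 0\<close>; the only unknown
  coefficient is the last one, and its value does not influence the number of real roots.
  The reciprocals of the roots are the roots of \<open>y^3 + n y^2 + C(n,2) y + a\<close>.  Were all
  three real, with multiplicity, their sum would be \<open>-n\<close> and their sum of squares \<open>n^2 - 2 C(n,2) = n\<close>, so the
  Cauchy-Schwarz inequality would give \<open>n^2 \<le> 3 n\<close>, which fails for \<open>n > 3\<close>.  A real cubic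
  that does not have three real roots has one real root and a pair of distinct complex
  conjugate ones.

  The coefficients are computed in \<open>acyclic_poly_dimension_3\<close>; the root count for the
  reversed cubic is \<open>monic_cubic_roots\<close>, where the Cauchy-Schwarz argument appears as the
  sign of the discriminant of the quadratic left after splitting off a real root.
\<close>

text \<open>
  A cycle visits as many distinct vertices as it has arcs, and undirected cycles are those
  with at least three arcs.
\<close>
lemma small_sets_acyclic:
  assumes "wf_digraph G" "finite (verts G)" "S \<subseteq> verts G" "card S \<le> 2"
  shows "S \<in> acyclic_sets G"
proof -
  have "length p \<le> 2" if cyc: "pre_digraph.cycle (G \<restriction> S) p" for p
  proof -
    interpret H: wf_digraph "G \<restriction> S"
      using assms(1) by (rule wf_digraph.wellformed_induce_subgraph)
    obtain u where p: "H.awalk u p u" "distinct (tl (H.awalk_verts u p))"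
      using cyc unfolding H.cycle_def by blast
    have sub: "set (tl (H.awalk_verts u p)) \<subseteq> S"
      proof -
      have "set (H.awalk_verts u p) \<subseteq> S"
        using p(1) unfolding H.awalk_conv by simp
      moreover have "H.awalk_verts u p \<noteq> []"
        by simp
      ultimately show ?thesis
        using list.set_sel(2) by fast
    qed
    have "length p = card (set (tl (H.awalk_verts u p)))"
      using p(2) by (simp add: distinct_card H.length_awalk_verts)
    also have "\<dots> \<le> card S"
      using finite_subset[OF assms(3,2)] sub by (rule card_mono)
    finally show ?thesis using assms(4) by simp
  qed
  then show ?thesis
    using assms(3) unfolding acyclic_sets_def acyclic_graph_def by fastforce
qed

lemma acyclic_count_small:
  assumes "wf_digraph G" "finite (verts G)" "i \<le> 2"
  shows "acyclic_count G i = card (verts G) choose i"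
proof -
  have "{S \<in> acyclic_sets G. card S = i} = {S. S \<subseteq> verts G \<and> card S = i}"
    using small_sets_acyclic[OF assms(1,2)] assms(3) by (auto simp: acyclic_sets_def)
  then show ?thesis
    using n_subsets[OF assms(2), of i] by (simp add: acyclic_count_def)
qed

lemma acyclic_poly_dimension_3:
  assumes "wf_digraph G" "finite (verts G)" "acyclic_dimension G = 3"
  obtains a :: nat where "a > 0"
    "acyclic_poly G = [:1, int (card (verts G)), int (card (verts G) choose 2), int a:]"
proof
  have deg: "degree (acyclic_poly G) = 3"
    using degree_acyclic_poly[OF assms(2)] assms(3) by simp
  then have "coeff (acyclic_poly G) 3 \<noteq> 0"
    by (metis leading_coeff_0_iff degree_0 zero_neq_numeral)
  then show "acyclic_count G 3 > 0"
    by (simp add: coeff_acyclic_poly[OF assms(2)])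
  show "acyclic_poly G =
      [:1, int (card (verts G)), int (card (verts G) choose 2), int (acyclic_count G 3):]"
  proof (rule poly_eqI)
    fix i :: nat
    consider "i = 0" | "i = 1" | "i = 2" | "i = 3" | "i > 3" by linarith
    then show "coeff (acyclic_poly G) i = coeff [:1, int (card (verts G)),
        int (card (verts G) choose 2), int (acyclic_count G 3):] i"
    proof cases
      case 5
      then show ?thesis using deg
        by (subst (1 2) coeff_eq_0) auto
    qed (simp_all add: coeff_acyclic_poly[OF assms(2)] acyclic_count_small[OF assms(1,2)]
        numeral_2_eq_2 numeral_3_eq_3)
  qed
qed

text \<open>
  The hypothesis on \<open>b\<close> says that the squares of the roots sum to \<open>n\<close>.  Dividing by \<open>y - s\<close>
  for a real root \<open>s\<close> leaves a real quadratic with negative discriminant, whose roots are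
  \<open>w\<close> and its conjugate.
\<close>
lemma monic_cubic_roots:
  fixes n b a :: real
  assumes n: "n > 3" and b: "2 * b = n * (n - 1)" and a: "a > 0"
  obtains s :: real and w :: complex where "s \<noteq> 0" "w \<notin> \<real>"
    "\<And>y :: complex. y ^ 3 + n * y ^ 2 + b * y + a = (y - s) * (y - w) * (y - cnj w)"
proof -
  define g where "g y = y ^ 3 + n * y ^ 2 + b * y + a" for y :: real
  have "b > 0"
  proof -
    have "n * (n - 1) > 0" using n by simp
    then show ?thesis using b by simp
  qed
  \<comment> \<open>The point \<open>- (n + a)\<close> turns the two leading terms into \<open>- a (n + a)^2\<close>, which outweighs \<open>a\<close>.\<close>
  have "g (- (n + a)) \<le> 0"
  proof -
    have "1 * 1 \<le> (n + a) * (n + a)"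
      using n a by (intro mult_mono) auto
    then have "a * 1 \<le> a * ((n + a) * (n + a))"
      using a by (intro mult_left_mono) auto
    moreover have "b * (n + a) \<ge> 0" using \<open>b > 0\<close> n a by simp
    moreover have "g (- (n + a)) = - (a * ((n + a) * (n + a))) - b * (n + a) + a"
      by (simp add: g_def algebra_simps power2_eq_square power3_eq_cube)
    ultimately show ?thesis by linarith
  qed
  moreover have "g 0 \<ge> 0" using a by (simp add: g_def)
  moreover have "continuous_on {- (n + a)..0} g"
    unfolding g_def by (intro continuous_intros)
  ultimately obtain s where s: "g s = 0"
    using IVT'[of g "- (n + a)" 0 0] n a by fastforce
  \<comment> \<open>The discriminant of the cofactor \<open>y^2 + (n + s) y + (b + n s + s^2)\<close>.\<close>
  define D where "D = (n + s)\<^sup>2 - 4 * (b + n * s + s\<^sup>2)"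
  have "3 * D = - (3 * s + n)\<^sup>2 - 2 * n * (n - 3)"
    using b by (simp add: D_def power2_eq_square algebra_simps)
  moreover have "2 * n * (n - 3) > 0" using n by simp
  ultimately have D: "D < 0" using zero_le_power2[of "3 * s + n"] by linarith
  define w where "w = Complex (- (n + s) / 2) (sqrt (- D) / 2)"
  show ?thesis
  proof
    show "s \<noteq> 0" using s a by (auto simp: g_def)
    show "w \<notin> \<real>" using D by (simp add: w_def complex_is_Real_iff)
    fix y :: complex
    have sum: "w + cnj w = of_real (- (n + s))"
      by (simp add: w_def complex_eq_iff)
    have prod: "w * cnj w = of_real (b + n * s + s\<^sup>2)"
      using D by (simp add: w_def complex_eq_iff D_def power2_eq_square field_simps)
    have a_eq: "a = - (s * (b + n * s + s\<^sup>2))"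
      using s by (simp add: g_def algebra_simps power2_eq_square power3_eq_cube)
    have "(y - s) * (y - w) * (y - cnj w) = (y - s) * (y\<^sup>2 - (w + cnj w) * y + w * cnj w)"
      by (simp add: algebra_simps power2_eq_square)
    also have "\<dots> = y ^ 3 + n * y ^ 2 + b * y + a"
      unfolding sum prod a_eq by (simp add: algebra_simps power2_eq_square power3_eq_cube)
    finally show "y ^ 3 + n * y ^ 2 + b * y + a = (y - s) * (y - w) * (y - cnj w)" ..
  qed
qed

text \<open>
  Inversion is a bijection between the roots here and those of the reversed cubic, since \<open>0\<close>
  is a root of neither, and it preserves being real.
\<close>
lemma reciprocal_cubic_roots:
  fixes n b a :: real
  assumes "n > 3" "2 * b = n * (n - 1)" "a > 0"
  defines "R \<equiv> {z :: complex. 1 + n * z + b * z ^ 2 + a * z ^ 3 = 0}"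
  shows "card (R \<inter> \<real>) = 1 \<and> card (R - \<real>) = 2"
proof -
  obtain s w where s: "s \<noteq> 0" and w: "w \<notin> \<real>" and
    fact: "\<And>y :: complex. y ^ 3 + n * y ^ 2 + b * y + a = (y - of_real s) * (y - w) * (y - cnj w)"
    using monic_cubic_roots[OF assms(1-3)] by metis
  have "z \<in> R \<longleftrightarrow> z \<in> inverse ` {of_real s, w, cnj w}" for z
  proof (cases "z = 0")
    case True
    then show ?thesis using s w by (auto simp: R_def)
  next
    case False
    have "1 + n * z + b * z ^ 2 + a * z ^ 3
        = z ^ 3 * (inverse z ^ 3 + n * inverse z ^ 2 + b * inverse z + a)"
      using False by (simp add: field_simps power2_eq_square power3_eq_cube)
    then have "z \<in> R \<longleftrightarrow> inverse z \<in> {of_real s, w, cnj w}"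
      using False unfolding fact by (simp add: R_def disj_assoc)
    then show ?thesis by (metis (no_types, lifting) image_iff inverse_inverse_eq)
  qed
  then have R: "R = {inverse (of_real s), inverse w, inverse (cnj w)}" by auto
  have cw: "cnj w \<notin> \<real>" "w \<noteq> cnj w"
    using w by (auto simp: complex_is_Real_iff complex_eq_iff)
  then have notin: "inverse w \<notin> \<real>" "inverse (cnj w) \<notin> \<real>"
    using w by (metis Reals_inverse inverse_inverse_eq)+
  have "R \<inter> \<real> = {inverse (of_real s)}" "R - \<real> = {inverse w, inverse (cnj w)}"
    using notin unfolding R by auto
  then show ?thesis using cw by simp
qed

theorem theorem2p6:
  fixes G :: "('a, 'b) pre_digraph"
  assumes "graph G"
    and "card (verts G) > 3"
    and "acyclic_dimension G = 3"
  shows "card {z :: complex. poly (map_poly of_int (acyclic_poly G)) z = 0 \<and> z \<in> \<real>} = 1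
    \<and> card {z :: complex. poly (map_poly of_int (acyclic_poly G)) z = 0 \<and> z \<notin> \<real>} = 2"
proof -
  interpret graph G by fact
  obtain a where a: "a > 0" and P:
    "acyclic_poly G = [:1, int (card (verts G)), int (card (verts G) choose 2), int a:]"
    using acyclic_poly_dimension_3[OF wf_digraph_axioms finite_verts assms(3)] by blast
  define n b where "n = real (card (verts G))" and "b = real (card (verts G) choose 2)"
  have b: "2 * b = n * (n - 1)"
  proof -
    have "even (card (verts G) * (card (verts G) - 1))"
      by (metis even_mult_iff even_Suc not0_implies_Suc diff_Suc_1 even_zero)
    then have "2 * (card (verts G) choose 2) = card (verts G) * (card (verts G) - 1)"
      by (simp add: choose_two)
    then have "real (2 * (card (verts G) choose 2)) = real (card (verts G) * (card (verts G) - 1))"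
      by simp
    then show ?thesis using assms(2) by (simp add: n_def b_def of_nat_diff)
  qed
  have roots: "poly (map_poly of_int (acyclic_poly G)) z = 1 + n * z + b * z ^ 2 + real a * z ^ 3"
    for z :: complex
    by (simp add: P n_def b_def map_poly_pCons algebra_simps power2_eq_square power3_eq_cube)
  show ?thesis
    using reciprocal_cubic_roots[of n b "real a"] b a assms(2) unfolding roots
    by (simp add: n_def Int_def set_diff_eq)
qed

end
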